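(* Let $q$ be a prime power and $n\ge2$ with $\gcd(q,n)=1$, and use the notation of the context. Let $C\subset\mathbb{F}_qD_n$ be a nonzero dihedral code such that $$\mathcal{P}(C)=\bigoplus_{j=1}^{r+s}B_j,\qquad B_j=\begin{cases}A_j,&j\in J_1\\ I_j(0,1),&j\in J_2\\ I_j(1,0),&j\in J_3\\ I_j(-x_j,1),&j\in J_4\\ 0,&j\notin J_1\cup J_2\cup J_3\cup J_4,\end{cases}$$ where $0\ne x_j\in F_j$, the sets $J_1,J_2,J_3\subset\{1,\dots,r+s\}$, $J_4\subset\{\zeta(n)+1,\dots,r+s\}$ are pairwise disjoint (with $1\notin J_2$ if $q$ is even), and $$J_1=J_2\cap\{r+1,\dots,r+s\}=J_3\cap\{r+1,\dots,r+s\}=\varnothing.$$ Then $d(C)\ge2d(C_{ext})$.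
   Context: $D_n=\langle a,b\mid a^n=1,\ b^2=1,\ bab=a^{-1}\rangle$ is the dihedral group of order $2n$, $\mathbb{F}_qD_n$ its group algebra; every element is uniquely $P(a)+bQ(a)$ with $P,Q\in\mathbb{F}_q[x]$ of degree less than $n$. A dihedral code is a left ideal of $\mathbb{F}_qD_n$. The Hamming weight of $u=\sum_g u_gg$ is $w(u)=|\{g\mid u_g\neq0\}|$, and $d(C)=\min_{0\ne c\in C}w(c)$. Let $\mathrm{pr}_a:\mathbb{F}_qD_n\to\mathbb{F}_q\langle a\rangle$, $P(a)+bQ(a)\mapsto P(a)$, where $\mathbb{F}_q\langle a\rangle\subset\mathbb{F}_qD_n$ is the group algebra of the cyclic subgroup generated by $a$. The exterior induced code is $C_{ext}=(\mathbb{F}_qD_n)\,\mathrm{pr}_a(C)$, the left ideal generated by $\mathrm{pr}_a(C)$. For $g\in\mathbb{F}_q[x]$ with $g(0)\neq0$ put $g^*(x)=x^{\deg g}g(x^{-1})$. Factor $x^n-1$ over $\mathbb{F}_q$ into (pairwise distinct) monic irreducible factors as $x^n-1=(f_1f_2\cdots f_r)(f_{r+1}f_{r+1}^*\cdots f_{r+s}f_{r+s}^* )$, where $f_1=x-1$, $f_2=x+1$ if $n$ is even, $f_j^*=f_j$ for $1<j\le r$, and for $j>r$ the polynomials $f_j$ and $f_j^*$ have different roots (here the factor $f_j^*$, $j>r$, is normalized by a scalar to be monic). Let $\alpha_j$ be a root of $f_j$. Let $\zeta(n)=1$ if $n$ is odd, $\zeta(n)=2$ if $n$ is even. $\langle h\mid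 h^2\rangle$ is the cyclic group of order 2 generated by $h$. Put $F_j=\mathbb{F}_q$ for $1\le j\le\zeta(n)$, $F_j=\mathbb{F}_q[\alpha_j+\alpha_j^{-1}]$ for $\zeta(n)+1\le j\le r$, $F_j=\mathbb{F}_q[\alpha_j]$ for $r+1\le j\le r+s$. Put $A_j=\mathbb{F}_q\langle h\mid h^2\rangle$ for $1\le j\le\zeta(n)$ and $A_j=\mathrm{M}_2(F_j)$ for $\zeta(n)+1\le j\le r+s$. Define for $u=P(a)+bQ(a)$: $\gamma_1(u)=P(1)+Q(1)h$; $\gamma_2(u)=P(-1)+Q(-1)h$ (for $n$ even); for $j\ge\zeta(n)+1$, $\tau_j(u)=\begin{pmatrix}P(\alpha_j)&Q(\alpha_j^{-1})\\ Q(\alpha_j)&P(\alpha_j^{-1})\end{pmatrix}$; for $\zeta(n)+1\le j\le r$, $\sigma_j(X)=Z_j^{-1}XZ_j$ with $Z_j=\begin{pmatrix}1&-\alpha_j\\ 1&-\alpha_j^{-1}\end{pmatrix}$. Put $\mathcal{P}_j=\gamma_j$ for $j\le\zeta(n)$, $\mathcal{P}_j=\sigma_j\tau_j$ for $\zeta(n)+1\le j\le r$, $\mathcal{P}_j=\tau_j$ for $r+1\le j\le r+s$. It is known that $\mathcal{P}=\bigoplus_{j=1}^{r+s}\mathcal{P}_j:\mathbb{F}_qD_n\to\bigoplus_{j=1}^{r+s}A_j$ is an algebra isomorphism. For $x,y\in F_j$ put $I_j(x,y)=\mathbb{F}_q\langle h\mid h^2\rangle\left[(x+y)+(x-y)h\right]$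 for $1\le j\le\zeta(n)$, and $I_j(x,y)=\left\{\begin{pmatrix}ky & -kx \\ ty & -tx\end{pmatrix}\mid k,t\in F_j\right\}$ for $\zeta(n)+1\le j\le r+s$. *)

theory Defs
  imports
    "HOL-Algebra.Algebraic_Closure_Type"
    "HOL-Algebra.Elementary_Groups"
    "HOL-Analysis.Finite_Cartesian_Product"
    "HOL-Analysis.Cartesian_Space"
    "HOL-Library.FuncSet"
begin

definition group_algebra :: "('g, 'm) monoid_scheme \<Rightarrow> ('g \<Rightarrow> 'a::comm_ring_1) ring" where
  "group_algebra G = \<lparr>
     carrier = {u. finite {g. u g \<noteq> 0} \<and> {g. u g \<noteq> 0} \<subseteq> carrier G},
     monoid.mult = (\<lambda>u v g. \<Sum>h\<in>{h. u h \<noteq> 0}. \<Sum>k\<in>{k. v k \<noteq> 0}.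
                      if h \<otimes>\<^bsub>G\<^esub> k = g then u h * v k else 0),
     one = (\<lambda>g. if g = \<one>\<^bsub>G\<^esub> then 1 else 0),
     zero = (\<lambda>_. 0),
     add = (\<lambda>u v g. u g + v g)\<rparr>"

definition left_ideal :: "'b set \<Rightarrow> ('b, 'm) ring_scheme \<Rightarrow> bool" where
  "left_ideal I R \<longleftrightarrow>
     additive_subgroup I R \<and> (\<forall>x\<in>carrier R. \<forall>y\<in>I. x \<otimes>\<^bsub>R\<^esub> y \<in> I)"

definition gen_left_ideal :: "('b, 'm) ring_scheme \<Rightarrow> 'b set \<Rightarrow> 'b set" where
  "gen_left_ideal R S = \<Inter>{I. left_ideal I R \<and> S \<subseteq> I}"

definition hamming_weight :: "('g \<Rightarrow> 'a::zero) \<Rightarrow> nat" where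
  "hamming_weight u = card {g. u g \<noteq> 0}"

definition min_distance :: "('g \<Rightarrow> 'a::zero) set \<Rightarrow> nat" where
  "min_distance C = Min (hamming_weight ` (C - {\<lambda>_. 0}))"

text \<open>The pair \<open>(e, i)\<close> stands for \<open>b\<^sup>e a\<^sup>i\<close>, so that \<open>a = (False, 1)\<close> and \<open>b = (True, 0)\<close>;
  the product is read off from \<open>a\<^sup>i b = b a\<^sup>-\<^sup>i\<close>.\<close>

definition dihedral_group :: "nat \<Rightarrow> (bool \<times> int) monoid" where
  "dihedral_group n = \<lparr>
     carrier = UNIV \<times> {0..<int n},
     monoid.mult = (\<lambda>(e, i) (f, j). (e \<noteq> f, ((if f then - i else i) + j) mod int n)),
     one = (False, 0)\<rparr>"

abbreviation dihedral_algebra :: "nat \<Rightarrow> (bool \<times> int \<Rightarrow> 'a::comm_ring_1) ring" where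
  "dihedral_algebra n \<equiv> group_algebra (dihedral_group n)"

text \<open>The unique polynomials of degree less than \<open>n\<close> with \<open>u = P(a) + b Q(a)\<close>.\<close>

definition P_poly :: "nat \<Rightarrow> (bool \<times> int \<Rightarrow> 'a::comm_ring_1) \<Rightarrow> 'a poly" where
  "P_poly n u = (\<Sum>i<n. Polynomial.monom (u (False, int i)) i)"

definition Q_poly :: "nat \<Rightarrow> (bool \<times> int \<Rightarrow> 'a::comm_ring_1) \<Rightarrow> 'a poly" where
  "Q_poly n u = (\<Sum>i<n. Polynomial.monom (u (True, int i)) i)"

definition pr_a :: "(bool \<times> int \<Rightarrow> 'a::zero) \<Rightarrow> bool \<times> int \<Rightarrow> 'a" where
  "pr_a u = (\<lambda>(e, i). if e then 0 else u (e, i))"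

definition exterior_code ::
  "nat \<Rightarrow> (bool \<times> int \<Rightarrow> 'a::comm_ring_1) set \<Rightarrow> (bool \<times> int \<Rightarrow> 'a) set" where
  "exterior_code n C = gen_left_ideal (dihedral_algebra n) (pr_a ` C)"

definition zeta :: "nat \<Rightarrow> nat" where
  "zeta n = (if even n then 2 else 1)"

text \<open>The library's \<open>reflect_poly g\<close> is \<open>x\<^bsup>deg g\<^esup> g(1/x)\<close>.\<close>

definition monic_reflect :: "'a::field poly \<Rightarrow> 'a poly" where
  "monic_reflect g = smult (inverse (lead_coeff (reflect_poly g))) (reflect_poly g)"

definition ac_roots :: "'a::field poly \<Rightarrow> 'a alg_closure set" where
  "ac_roots g = {z. poly (map_poly to_ac g) z = 0}"

definition factor_list :: "nat \<Rightarrow> nat \<Rightarrow> (nat \<Rightarrow> 'a::field poly) \<Rightarrow> 'a poly list" where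
  "factor_list r s f =
     map f [1..<r + 1] @ concat (map (\<lambda>j. [f j, monic_reflect (f j)]) [r + 1..<r + s + 1])"

definition reciprocal_factorization ::
  "nat \<Rightarrow> nat \<Rightarrow> nat \<Rightarrow> (nat \<Rightarrow> 'a::field poly) \<Rightarrow> bool" where
  "reciprocal_factorization n r s f \<longleftrightarrow>
     Polynomial.monom 1 n - 1 = prod_list (factor_list r s f) \<and>
     distinct (factor_list r s f) \<and>
     (\<forall>g\<in>set (factor_list r s f). lead_coeff g = 1 \<and> irreducible g) \<and>
     zeta n \<le> r \<and>
     f 1 = [:-1, 1:] \<and>
     (even n \<longrightarrow> f 2 = [:1, 1:]) \<and>
     (\<forall>j. 1 < j \<and> j \<le> r \<longrightarrow> reflect_poly (f j) = f j) \<and>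
     (\<forall>j\<in>{r+1..r+s}. ac_roots (f j) \<inter> ac_roots (reflect_poly (f j)) = {})"

definition adjoin :: "'a::field alg_closure \<Rightarrow> 'a alg_closure set" where
  "adjoin z = {poly (map_poly to_ac p) z | p. True}"

text \<open>All fields \<open>F\<^sub>j\<close> live in the algebraic closure; for \<open>j \<le> zeta n\<close> the base field is identified
  with its image under \<open>to_ac\<close>, and \<open>of_ac\<close> is the inverse identification.\<close>

definition comp_field :: "nat \<Rightarrow> nat \<Rightarrow> (nat \<Rightarrow> 'a::field alg_closure) \<Rightarrow> nat \<Rightarrow> 'a alg_closure set" where
  "comp_field n r \<alpha> j =
     (if j \<le> zeta n then range to_ac
      else if j \<le> r then adjoin (\<alpha> j + inverse (\<alpha> j))
      else adjoin (\<alpha> j))"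

definition mat2 :: "'k::zero \<Rightarrow> 'k \<Rightarrow> 'k \<Rightarrow> 'k \<Rightarrow> 'k^2^2" where
  "mat2 a b c d = vector [vector [a, b], vector [c, d]]"

text \<open>The generator \<open>h\<close> of the cyclic group of order 2 is \<open>1\<close> in \<open>integer_mod_group 2\<close>.\<close>

abbreviation C2_algebra :: "(int \<Rightarrow> 'a::comm_ring_1) ring" where
  "C2_algebra \<equiv> group_algebra (integer_mod_group 2)"

definition c2 :: "'a::comm_ring_1 \<Rightarrow> 'a \<Rightarrow> int \<Rightarrow> 'a" where
  "c2 x y = (\<lambda>g. if g = 0 then x else if g = 1 then y else 0)"

text \<open>Elements of the \<open>A\<^sub>j\<close>: \<open>Inl\<close> for the commutative components \<open>j \<le> zeta n\<close>, \<open>Inr\<close> for the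
  matrix components.\<close>

type_synonym 'a component = "(int \<Rightarrow> 'a) + ('a alg_closure)^2^2"

definition comp_zero :: "nat \<Rightarrow> nat \<Rightarrow> 'a::field component" where
  "comp_zero n j = (if j \<le> zeta n then Inl \<zero>\<^bsub>C2_algebra\<^esub> else Inr 0)"

definition comp_A :: "nat \<Rightarrow> nat \<Rightarrow> (nat \<Rightarrow> 'a::field alg_closure) \<Rightarrow> nat \<Rightarrow> 'a component set" where
  "comp_A n r \<alpha> j =
     (if j \<le> zeta n then Inl ` carrier C2_algebra
      else Inr ` {M. \<forall>k l. M $ k $ l \<in> comp_field n r \<alpha> j})"

definition comp_I ::
  "nat \<Rightarrow> nat \<Rightarrow> (nat \<Rightarrow> 'a::field alg_closure) \<Rightarrow> nat \<Rightarrow> 'a alg_closure \<Rightarrow> 'a alg_closure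
     \<Rightarrow> 'a component set" where
  "comp_I n r \<alpha> j x y =
     (if j \<le> zeta n
      then Inl ` {w \<otimes>\<^bsub>C2_algebra\<^esub> c2 (of_ac x + of_ac y) (of_ac x - of_ac y) | w.
                    w \<in> carrier C2_algebra}
      else Inr ` {mat2 (k * y) (- k * x) (t * y) (- t * x) | k t.
                    k \<in> comp_field n r \<alpha> j \<and> t \<in> comp_field n r \<alpha> j})"

definition gamma :: "nat \<Rightarrow> 'a::field \<Rightarrow> (bool \<times> int \<Rightarrow> 'a) \<Rightarrow> int \<Rightarrow> 'a" where
  "gamma n z u = c2 (poly (P_poly n u) z) (poly (Q_poly n u) z)"

definition tau :: "nat \<Rightarrow> 'a::field alg_closure \<Rightarrow> (bool \<times> int \<Rightarrow> 'a) \<Rightarrow> ('a alg_closure)^2^2" where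
  "tau n z u =
     (let P = map_poly to_ac (P_poly n u); Q = map_poly to_ac (Q_poly n u)
      in mat2 (poly P z) (poly Q (inverse z)) (poly Q z) (poly P (inverse z)))"

definition sigma :: "'k::field \<Rightarrow> 'k^2^2 \<Rightarrow> 'k^2^2" where
  "sigma z M = (let Z = mat2 1 (- z) 1 (- inverse z) in matrix_inv Z ** M ** Z)"

definition comp_map ::
  "nat \<Rightarrow> nat \<Rightarrow> (nat \<Rightarrow> 'a::field alg_closure) \<Rightarrow> nat \<Rightarrow> (bool \<times> int \<Rightarrow> 'a) \<Rightarrow> 'a component" where
  "comp_map n r \<alpha> j u =
     (if j \<le> zeta n then Inl (gamma n (if j = 1 then 1 else - 1) u)
      else if j \<le> r then Inr (sigma (\<alpha> j) (tau n (\<alpha> j) u))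
      else Inr (tau n (\<alpha> j) u))"

text \<open>The finite direct sum of the components is the set \<open>PiE {1..r+s} (comp_A n r \<alpha>)\<close> of families.\<close>

definition decomposition ::
  "nat \<Rightarrow> nat \<Rightarrow> nat \<Rightarrow> (nat \<Rightarrow> 'a::field alg_closure) \<Rightarrow> (bool \<times> int \<Rightarrow> 'a)
     \<Rightarrow> nat \<Rightarrow> 'a component" where
  "decomposition n r s \<alpha> u = (\<lambda>j\<in>{1..r+s}. comp_map n r \<alpha> j u)"

lemma group_dihedral_group:
  assumes "n > 0"
  shows "group (dihedral_group n)"
proof (rule groupI)
  fix x y z
  assume "x \<in> carrier (dihedral_group n)" "y \<in> carrier (dihedral_group n)"
    "z \<in> carrier (dihedral_group n)"
  then show "x \<otimes>\<^bsub>dihedral_group n\<^esub> y \<otimes>\<^bsub>dihedral_group n\<^esub> z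
      = x \<otimes>\<^bsub>dihedral_group n\<^esub> (y \<otimes>\<^bsub>dihedral_group n\<^esub> z)"
    by (auto simp: dihedral_group_def mod_simps algebra_simps split: prod.splits)
next
  fix x assume x: "x \<in> carrier (dihedral_group n)"
  obtain e i where ei: "x = (e, i)" by (cases x)
  show "\<exists>y\<in>carrier (dihedral_group n). y \<otimes>\<^bsub>dihedral_group n\<^esub> x = \<one>\<^bsub>dihedral_group n\<^esub>"
    using x assms
    by (intro bexI[of _ "(e, (if e then i else - i) mod int n)"])
       (auto simp: ei dihedral_group_def mod_simps)
qed (use assms in \<open>auto simp: dihedral_group_def\<close>)

lemma dihedral_group_presentation:
  fixes n :: nat
  assumes "n \<ge> 2"
  defines "G \<equiv> dihedral_group n" and "a \<equiv> (False, 1 :: int)" and "b \<equiv> (True, 0 :: int)"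
  shows "card (carrier G) = 2 * n"
    and "a [^]\<^bsub>G\<^esub> n = \<one>\<^bsub>G\<^esub>" and "b [^]\<^bsub>G\<^esub> (2::nat) = \<one>\<^bsub>G\<^esub>"
    and "b \<otimes>\<^bsub>G\<^esub> a \<otimes>\<^bsub>G\<^esub> b = inv\<^bsub>G\<^esub> a"
    and "carrier G = {b [^]\<^bsub>G\<^esub> e \<otimes>\<^bsub>G\<^esub> a [^]\<^bsub>G\<^esub> i | e i. e < (2::nat) \<and> i < n}"
proof -
  interpret group G
    using assms group_dihedral_group by simp
  have n: "0 < int n" "1 < n"
    using assms(1) by simp_all
  have pow_a: "a [^]\<^bsub>G\<^esub> k = (False, int k mod int n)" for k :: nat
    by (induction k) (auto simp: assms dihedral_group_def nat_pow_def mod_simps add.commute)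
  have pow_b: "b [^]\<^bsub>G\<^esub> (0::nat) = (False, 0)" "b [^]\<^bsub>G\<^esub> (1::nat) = (True, 0)"
    "b [^]\<^bsub>G\<^esub> (2::nat) = (False, 0)"
    using assms(1) by (auto simp: assms dihedral_group_def nat_pow_def numeral_2_eq_2)
  show "card (carrier G) = 2 * n"
    by (simp add: assms dihedral_group_def)
  show "a [^]\<^bsub>G\<^esub> n = \<one>\<^bsub>G\<^esub>"
    unfolding pow_a by (simp add: assms dihedral_group_def)
  show "b [^]\<^bsub>G\<^esub> (2::nat) = \<one>\<^bsub>G\<^esub>"
    unfolding pow_b by (simp add: assms dihedral_group_def)
  show "b \<otimes>\<^bsub>G\<^esub> a \<otimes>\<^bsub>G\<^esub> b = inv\<^bsub>G\<^esub> a"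
    by (rule inv_equality[symmetric])
       (use n in \<open>auto simp: assms(2-) dihedral_group_def mod_simps\<close>)
  show "carrier G = {b [^]\<^bsub>G\<^esub> e \<otimes>\<^bsub>G\<^esub> a [^]\<^bsub>G\<^esub> i | e i. e < (2::nat) \<and> i < n}" (is "_ = ?R")
  proof
    show "carrier G \<subseteq> ?R"
    proof
      fix x assume x: "x \<in> carrier G"
      obtain e i where ei: "x = (e, i)" by (cases x)
      have i: "0 \<le> i" "i < int n" using x by (auto simp: ei assms dihedral_group_def)
      have "x = b [^]\<^bsub>G\<^esub> (of_bool e :: nat) \<otimes>\<^bsub>G\<^esub> a [^]\<^bsub>G\<^esub> nat i"
        unfolding pow_a using i pow_b
        by (cases e) (simp_all add: ei, simp_all add: assms(2) dihedral_group_def)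
      moreover have "(of_bool e :: nat) < 2" "nat i < n" using i by auto
      ultimately show "x \<in> ?R" by blast
    qed
    have "a \<in> carrier G" "b \<in> carrier G"
      using n by (auto simp: assms(2-) dihedral_group_def)
    then show "?R \<subseteq> carrier G" by auto
  qed
qed

lemma group_algebra_mult:
  assumes "finite A" "finite B" "{g. u g \<noteq> 0} \<subseteq> A" "{g. v g \<noteq> 0} \<subseteq> B"
  shows "(u \<otimes>\<^bsub>group_algebra G\<^esub> v) g =
    (\<Sum>h\<in>A. \<Sum>k\<in>B. if h \<otimes>\<^bsub>G\<^esub> k = g then u h * v k else 0)"
proof -
  have "(\<Sum>k\<in>{k. v k \<noteq> 0}. if h \<otimes>\<^bsub>G\<^esub> k = g then u h * v k else 0) =
      (\<Sum>k\<in>B. if h \<otimes>\<^bsub>G\<^esub> k = g then u h * v k else 0)" for h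
    by (rule sum.mono_neutral_left) (use assms in auto)
  then have "(u \<otimes>\<^bsub>group_algebra G\<^esub> v) g =
      (\<Sum>h\<in>{h. u h \<noteq> 0}. \<Sum>k\<in>B. if h \<otimes>\<^bsub>G\<^esub> k = g then u h * v k else 0)"
    by (simp add: group_algebra_def)
  also have "\<dots> = (\<Sum>h\<in>A. \<Sum>k\<in>B. if h \<otimes>\<^bsub>G\<^esub> k = g then u h * v k else 0)"
    by (rule sum.mono_neutral_left) (use assms in \<open>auto intro!: sum.neutral split: if_splits\<close>)
  finally show ?thesis .
qed

lemma ring_group_algebra:
  assumes "group G"
  shows "ring (group_algebra G :: ('g \<Rightarrow> 'a::comm_ring_1) ring)" (is "ring ?R")
proof -
  interpret group G by fact
  note mult = group_algebra_mult
  have carrierI: "u \<in> carrier ?R" if "finite A" "A \<subseteq> carrier G" "{g. u g \<noteq> 0} \<subseteq> A" for u A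
    using that by (auto simp: group_algebra_def intro: finite_subset)
  have carrierD: "finite {g. u g \<noteq> 0}" "{g. u g \<noteq> 0} \<subseteq> carrier G" if "u \<in> carrier ?R" for u
    using that by (auto simp: group_algebra_def)
  have supp_mult: "{g. (u \<otimes>\<^bsub>?R\<^esub> v) g \<noteq> 0} \<subseteq> (\<lambda>(h, k). h \<otimes>\<^bsub>G\<^esub> k) ` (A \<times> B)"
    if "finite A" "finite B" "{g. u g \<noteq> 0} \<subseteq> A" "{g. v g \<noteq> 0} \<subseteq> B" for u v :: "'g \<Rightarrow> 'a" and A B
  proof (rule ccontr)
    assume "\<not> ?thesis"
    then obtain g where g: "(u \<otimes>\<^bsub>?R\<^esub> v) g \<noteq> 0" "\<And>h k. h \<in> A \<Longrightarrow> k \<in> B \<Longrightarrow> h \<otimes>\<^bsub>G\<^esub> k \<noteq> g"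
      by auto
    from g(2) have "(u \<otimes>\<^bsub>?R\<^esub> v) g = 0"
      unfolding mult[OF that] by (auto intro!: sum.neutral)
    with g(1) show False by contradiction
  qed
  have closed: "u \<otimes>\<^bsub>?R\<^esub> v \<in> carrier ?R" if "u \<in> carrier ?R" "v \<in> carrier ?R" for u v
    by (rule carrierI[OF _ _ supp_mult[OF carrierD(1)[OF that(1)] carrierD(1)[OF that(2)] order.refl order.refl]])
       (use carrierD[OF that(1)] carrierD[OF that(2)] in auto)
  show ?thesis
  proof (rule ringI)
    show "abelian_group ?R"
    proof (rule abelian_groupI)
      fix u v assume uv: "u \<in> carrier ?R" "v \<in> carrier ?R"
      have "{g. u g + v g \<noteq> 0} \<subseteq> {g. u g \<noteq> 0} \<union> {g. v g \<noteq> 0}" by auto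
      with uv show "u \<oplus>\<^bsub>?R\<^esub> v \<in> carrier ?R"
        by (auto simp: group_algebra_def intro: finite_subset)
    next
      fix u assume u: "u \<in> carrier ?R"
      show "\<exists>v\<in>carrier ?R. v \<oplus>\<^bsub>?R\<^esub> u = \<zero>\<^bsub>?R\<^esub>"
        by (rule bexI[of _ "\<lambda>g. - u g"]) (use u in \<open>auto simp: group_algebra_def\<close>)
    qed (auto simp: group_algebra_def algebra_simps)
    show "monoid ?R"
    proof (rule monoidI)
      show "\<one>\<^bsub>?R\<^esub> \<in> carrier ?R"
        by (rule carrierI[of "{\<one>\<^bsub>G\<^esub>}"]) (auto simp: group_algebra_def)
    next
      fix u v w assume uvw: "u \<in> carrier ?R" "v \<in> carrier ?R" "w \<in> carrier ?R"
      define A B D where "A = {g. u g \<noteq> 0}" and "B = {g. v g \<noteq> 0}" and "D = {g. w g \<noteq> 0}"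
      then have S: "finite A" "A \<subseteq> carrier G" "{g. u g \<noteq> 0} \<subseteq> A"
          "finite B" "B \<subseteq> carrier G" "{g. v g \<noteq> 0} \<subseteq> B"
          "finite D" "D \<subseteq> carrier G" "{g. w g \<noteq> 0} \<subseteq> D"
        using uvw[THEN carrierD(1)] uvw[THEN carrierD(2)] by simp_all
      let ?AB = "(\<lambda>(h, k). h \<otimes>\<^bsub>G\<^esub> k) ` (A \<times> B)" and ?BD = "(\<lambda>(h, k). h \<otimes>\<^bsub>G\<^esub> k) ` (B \<times> D)"
      show "u \<otimes>\<^bsub>?R\<^esub> v \<otimes>\<^bsub>?R\<^esub> w = u \<otimes>\<^bsub>?R\<^esub> (v \<otimes>\<^bsub>?R\<^esub> w)"
      proof
        fix g
        have "(u \<otimes>\<^bsub>?R\<^esub> v \<otimes>\<^bsub>?R\<^esub> w) g = (\<Sum>m\<in>?AB. \<Sum>l\<in>D. if m \<otimes>\<^bsub>G\<^esub> l = g then (u \<otimes>\<^bsub>?R\<^esub> v) m * w l else 0)"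
          by (rule mult) (use S supp_mult[OF S(1,4,3,6)] in auto)
        also have "\<dots> = (\<Sum>m\<in>?AB. \<Sum>l\<in>D. \<Sum>h\<in>A. \<Sum>k\<in>B.
            if m = h \<otimes>\<^bsub>G\<^esub> k then if m \<otimes>\<^bsub>G\<^esub> l = g then u h * v k * w l else 0 else 0)"
          unfolding mult[OF S(1,4,3,6)]
          by (rule sum.cong[OF refl], rule sum.cong[OF refl], rename_tac m l,
              case_tac "m \<otimes>\<^bsub>G\<^esub> l = g", auto simp: sum_distrib_right intro!: sum.cong sum.neutral)
        also have "\<dots> = (\<Sum>h\<in>A. \<Sum>k\<in>B. \<Sum>l\<in>D. \<Sum>m\<in>?AB.
            if m = h \<otimes>\<^bsub>G\<^esub> k then if m \<otimes>\<^bsub>G\<^esub> l = g then u h * v k * w l else 0 else 0)"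
          by (simp only: sum.cartesian_product)
             (rule sum.reindex_bij_witness[of _ "\<lambda>(h, k, l, m). (m, l, h, k)" "\<lambda>(m, l, h, k). (h, k, l, m)"];
              auto)
        also have "\<dots> = (\<Sum>h\<in>A. \<Sum>k\<in>B. \<Sum>l\<in>D. if h \<otimes>\<^bsub>G\<^esub> k \<otimes>\<^bsub>G\<^esub> l = g then u h * v k * w l else 0)"
          using S by (intro sum.cong refl) (subst sum.delta, auto)
        also have "\<dots> = (\<Sum>h\<in>A. \<Sum>k\<in>B. \<Sum>l\<in>D. if h \<otimes>\<^bsub>G\<^esub> (k \<otimes>\<^bsub>G\<^esub> l) = g then u h * v k * w l else 0)"
          using S by (intro sum.cong refl) (simp add: m_assoc subset_iff)
        also have "\<dots> = (\<Sum>h\<in>A. \<Sum>k\<in>B. \<Sum>l\<in>D. \<Sum>m\<in>?BD.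
            if m = k \<otimes>\<^bsub>G\<^esub> l then if h \<otimes>\<^bsub>G\<^esub> m = g then u h * (v k * w l) else 0 else 0)"
          using S by (intro sum.cong refl) (subst sum.delta, auto simp: mult.assoc)
        also have "\<dots> = (\<Sum>h\<in>A. \<Sum>m\<in>?BD. \<Sum>k\<in>B. \<Sum>l\<in>D.
            if m = k \<otimes>\<^bsub>G\<^esub> l then if h \<otimes>\<^bsub>G\<^esub> m = g then u h * (v k * w l) else 0 else 0)"
          by (simp only: sum.cartesian_product)
             (rule sum.reindex_bij_witness[of _ "\<lambda>(h, m, k, l). (h, k, l, m)" "\<lambda>(h, k, l, m). (h, m, k, l)"];
              auto)
        also have "\<dots> = (\<Sum>h\<in>A. \<Sum>m\<in>?BD. if h \<otimes>\<^bsub>G\<^esub> m = g then u h * (v \<otimes>\<^bsub>?R\<^esub> w) m else 0)"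
          unfolding mult[OF S(4,7,6,9)]
          by (rule sum.cong[OF refl], rule sum.cong[OF refl], rename_tac h m,
              case_tac "h \<otimes>\<^bsub>G\<^esub> m = g", auto simp: sum_distrib_left intro!: sum.cong sum.neutral)
        also have "\<dots> = (u \<otimes>\<^bsub>?R\<^esub> (v \<otimes>\<^bsub>?R\<^esub> w)) g"
          by (rule mult[symmetric]) (use S supp_mult[OF S(4,7,6,9)] in auto)
        finally show "(u \<otimes>\<^bsub>?R\<^esub> v \<otimes>\<^bsub>?R\<^esub> w) g = (u \<otimes>\<^bsub>?R\<^esub> (v \<otimes>\<^bsub>?R\<^esub> w)) g" .
      qed
    next
      fix u assume u: "u \<in> carrier ?R"
      define A where "A = {g. u g \<noteq> 0}"
      then have S: "finite A" "A \<subseteq> carrier G" "{g. u g \<noteq> 0} \<subseteq> A"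
        using u[THEN carrierD(1)] u[THEN carrierD(2)] by simp_all
      have one: "{g. \<one>\<^bsub>?R\<^esub> g \<noteq> (0::'a)} \<subseteq> {\<one>\<^bsub>G\<^esub>}" "\<one>\<^bsub>?R\<^esub> \<one>\<^bsub>G\<^esub> = (1::'a)"
        by (auto simp: group_algebra_def)
      show "\<one>\<^bsub>?R\<^esub> \<otimes>\<^bsub>?R\<^esub> u = u"
      proof
        fix g
        have "(\<one>\<^bsub>?R\<^esub> \<otimes>\<^bsub>?R\<^esub> u) g = (\<Sum>k\<in>A. if k = g then u k else 0)"
          unfolding mult[OF _ S(1) one(1) S(3), simplified]
          by (rule sum.cong) (use S(2) one(2) in auto)
        with S show "(\<one>\<^bsub>?R\<^esub> \<otimes>\<^bsub>?R\<^esub> u) g = u g" by auto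
      qed
      show "u \<otimes>\<^bsub>?R\<^esub> \<one>\<^bsub>?R\<^esub> = u"
      proof
        fix g
        have "(u \<otimes>\<^bsub>?R\<^esub> \<one>\<^bsub>?R\<^esub>) g = (\<Sum>k\<in>A. if k = g then u k else 0)"
          unfolding mult[OF S(1) _ S(3) one(1), simplified]
          by (rule sum.cong) (use S(2) one(2) in auto)
        with S show "(u \<otimes>\<^bsub>?R\<^esub> \<one>\<^bsub>?R\<^esub>) g = u g" by auto
      qed
    qed (rule closed)
  next
    fix u v w assume uvw: "u \<in> carrier ?R" "v \<in> carrier ?R" "w \<in> carrier ?R"
    define A where "A = {g. u g \<noteq> 0} \<union> {g. v g \<noteq> 0} \<union> {g. w g \<noteq> 0}"
    have A: "finite A" "{g. u g \<noteq> 0} \<subseteq> A" "{g. v g \<noteq> 0} \<subseteq> A" "{g. w g \<noteq> 0} \<subseteq> A"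
      "{g. (u \<oplus>\<^bsub>?R\<^esub> v) g \<noteq> 0} \<subseteq> A"
      using uvw by (auto simp: A_def group_algebra_def)
    have add: "(x \<oplus>\<^bsub>?R\<^esub> y) g = x g + y g" for x y g by (simp add: group_algebra_def)
    show "(u \<oplus>\<^bsub>?R\<^esub> v) \<otimes>\<^bsub>?R\<^esub> w = u \<otimes>\<^bsub>?R\<^esub> w \<oplus>\<^bsub>?R\<^esub> v \<otimes>\<^bsub>?R\<^esub> w"
      by (rule ext, unfold add mult[OF A(1,1,5,4)] mult[OF A(1,1,2,4)] mult[OF A(1,1,3,4)],
          unfold sum.distrib[symmetric])
         (auto intro!: sum.cong simp: algebra_simps)
    show "w \<otimes>\<^bsub>?R\<^esub> (u \<oplus>\<^bsub>?R\<^esub> v) = w \<otimes>\<^bsub>?R\<^esub> u \<oplus>\<^bsub>?R\<^esub> w \<otimes>\<^bsub>?R\<^esub> v"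
      by (rule ext, unfold add mult[OF A(1,1,4,5)] mult[OF A(1,1,4,2)] mult[OF A(1,1,4,3)],
          unfold sum.distrib[symmetric])
         (auto intro!: sum.cong simp: algebra_simps)
  qed
qed

end

theory Submission
  imports
    "HOL-Computational_Algebra.Polynomial_Factorial"
    "HOL-Analysis.Determinants"
    Defs
begin

text \<open>
  Write \<open>u = P(a) + b Q(a)\<close>. Multiplying by \<open>b\<close> exchanges \<open>P\<close> and \<open>Q\<close>, so for \<open>u \<in> C\<close> both \<open>P(a)\<close>
  and \<open>Q(a)\<close> are projections of words of \<open>C\<close> and lie in the exterior code, while
  \<open>w(u) = w(P) + w(Q)\<close> (\<open>hamming_weight_halves\<close>). The bound therefore holds as soon as neither half
  of a nonzero word vanishes. By the same exchange this reduces to one claim: a word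
  \<open>P(a)\<close> of \<open>C\<close>, with no \<open>b\<close>-part, is zero.

  For such a word the two-dimensional components have \<open>\<tau>\<^sub>j = diag(P(\<alpha>\<^sub>j), P(1/\<alpha>\<^sub>j))\<close> and the
  commutative ones are scalars \<open>P(\<plusminus>1)\<close>. No component of \<open>C\<close> is a full algebra, which leaves no
  room for such elements:

  \<^item> A scalar in the ideal generated by \<open>1 + h\<close> or \<open>1 - h\<close> is zero (\<open>comp_I_scalar_eq_0\<close>).

  \<^item> For a self-reciprocal \<open>f\<^sub>j\<close> the component ideal consists of singular matrices, and conjugation
    preserves the determinant (\<open>det_sigma\<close>), so \<open>P(\<alpha>\<^sub>j) P(1/\<alpha>\<^sub>j) = 0\<close>. Both points are roots of the
    irreducible \<open>f\<^sub>j\<close>; hence one zero forces the other.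

  \<^item> For a pair \<open>f\<^sub>j, f\<^sub>j\<^sup>*\<close> the rows of a matrix in \<open>I\<^sub>j(-x\<^sub>j, 1)\<close> are multiples of
    \<open>(1, x\<^sub>j)\<close> with \<open>x\<^sub>j \<noteq> 0\<close>, and only the zero matrix among them is diagonal. The ideals
    \<open>I\<^sub>j(0, 1)\<close> and \<open>I\<^sub>j(1, 0)\<close> do contain nonzero diagonal matrices, which is why \<open>J\<^sub>2\<close>
    and \<open>J\<^sub>3\<close> must avoid these indices.

  So \<open>P\<close> shares a root with every irreducible factor of \<open>x\<^sup>n - 1\<close>. The factors being distinct,
  \<open>x\<^sup>n - 1\<close> divides \<open>P\<close> (\<open>monom_minus_1_dvd\<close>), and \<open>deg P < n\<close> gives \<open>P = 0\<close>.
\<close>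

section \<open>Evaluating polynomials in the algebraic closure\<close>

lemma poly_to_ac_mult:
  "poly (map_poly to_ac (p * q)) z = poly (map_poly to_ac p) z * poly (map_poly to_ac q) z"
proof -
  have "map_poly to_ac (p * q) = map_poly to_ac p * map_poly to_ac q"
    by (rule poly_eqI) (simp add: coeff_map_poly coeff_mult to_ac_sum)
  then show ?thesis by simp
qed

lemma poly_map_poly_to_ac: "poly (map_poly to_ac p) (to_ac z) = to_ac (poly p z)"
  by (induction p) (simp_all add: map_poly_pCons)

lemma poly_to_ac_diff:
  "poly (map_poly to_ac (p - q)) z = poly (map_poly to_ac p) z - poly (map_poly to_ac q) z"
proof -
  have "map_poly to_ac (p - q) = map_poly to_ac p - map_poly to_ac q"
    by (rule poly_eqI) (simp add: coeff_map_poly)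
  then show ?thesis by simp
qed

lemma ac_roots_dvd:
  assumes "p dvd q" and "z \<in> ac_roots p"
  shows "z \<in> ac_roots q"
  using assms by (auto simp: ac_roots_def poly_to_ac_mult elim: dvdE)

text \<open>
  The polynomials over the base field with root \<open>z\<close> form an ideal. A generator \<open>m\<close> of it is not a
  unit and divides \<open>f\<close>, so it is associated with \<open>f\<close>.
\<close>
lemma irreducible_dvd_if_common_root:
  fixes f g :: "'a::field poly"
  assumes "irreducible f" and "z \<in> ac_roots f" and "z \<in> ac_roots g"
  shows "f dvd g"
proof -
  have "f \<noteq> 0" using assms(1) by auto
  then obtain m where m: "m \<noteq> 0 \<and> z \<in> ac_roots m"
    and least: "\<And>h. h \<noteq> 0 \<and> z \<in> ac_roots h \<Longrightarrow> Polynomial.degree m \<le> Polynomial.degree h"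
    using ex_has_least_nat[of "\<lambda>h. h \<noteq> 0 \<and> z \<in> ac_roots h" f Polynomial.degree] assms(2) by blast
  have dvd: "m dvd h" if "z \<in> ac_roots h" for h
  proof -
    have "h mod m = h - m * (h div m)"
      by (simp add: minus_mult_div_eq_mod)
    then have "z \<in> ac_roots (h mod m)"
      using m that by (simp add: ac_roots_def poly_to_ac_diff poly_to_ac_mult)
    moreover have "h mod m = 0 \<or> Polynomial.degree (h mod m) < Polynomial.degree m"
      using m by (intro degree_mod_less) auto
    ultimately show ?thesis
      using least[of "h mod m"] by (meson mod_eq_0_iff_dvd not_le)
  qed
  have "\<not> m dvd 1"
    using m ac_roots_dvd[of m 1 z] by (auto simp: ac_roots_def)
  moreover obtain c where c: "f = m * c"
    using dvd[OF assms(2)] by (elim dvdE)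
  ultimately have "c dvd 1"
    using irreducibleD[OF assms(1) c] by blast
  then have "f dvd m"
    unfolding c by simp
  then show ?thesis
    using dvd[OF assms(3)] by (rule dvd_trans)
qed

lemma monic_irreducible_dvd_eq:
  fixes f g :: "'a::field poly"
  assumes "irreducible f" and "irreducible g" and "Polynomial.lead_coeff f = 1" and "Polynomial.lead_coeff g = 1"
    and "f dvd g"
  shows "f = g"
proof -
  obtain c where c: "g = f * c" using assms(5) by (elim dvdE)
  have "\<not> f dvd 1" using assms(1) by (simp add: irreducible_not_unit)
  then have "c dvd 1" using irreducibleD[OF assms(2) c] by blast
  then obtain k where "c = [:k:]" by (auto simp: is_unit_poly_iff)
  moreover from this have "k = 1"
    using c assms(3,4) by (simp add: lead_coeff_mult split: if_splits)
  ultimately show ?thesis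
    by (simp add: c)
qed

text \<open>
  Monic irreducibles are normalized representatives of primes, so distinct ones are coprime and
  can be split off one after the other.
\<close>
lemma prod_list_monic_irreducible_dvd:
  fixes g :: "'a::field poly"
  assumes "distinct fs" and "\<forall>f\<in>set fs. Polynomial.lead_coeff f = 1 \<and> irreducible f"
    and "\<forall>f\<in>set fs. f dvd g"
  shows "prod_list fs dvd g"
  using assms
proof (induction fs arbitrary: g)
  case (Cons f fs)
  then have "f dvd g" by simp
  then obtain h where h: "g = f * h" by (elim dvdE)
  have "k dvd h" if k: "k \<in> set fs" for k
  proof -
    have "prime_elem k"
      using Cons.prems(2) k by (auto intro: field_poly_irreducible_imp_prime)
    moreover have "\<not> k dvd f"
      using monic_irreducible_dvd_eq[of k f] Cons.prems k by auto
    moreover have "k dvd f * h"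
      using Cons.prems(3) k h by auto
    ultimately show ?thesis
      by (simp add: prime_elem_dvd_mult_iff)
  qed
  then have "prod_list fs dvd h"
    using Cons by auto
  then show ?case
    by (simp add: h)
qed simp

section \<open>The factors of \<open>x\<^sup>n - 1\<close> and their roots\<close>

lemma set_factor_list:
  "set (factor_list r s f) = f ` {1..r+s} \<union> (monic_reflect \<circ> f) ` {r+1..r+s}"
proof -
  have "{1..r+s} = {1..r} \<union> {r+1..r+s}"
    by auto
  then show ?thesis
    by (auto simp: factor_list_def)
qed

lemma ac_roots_reflect_poly:
  assumes "z \<in> ac_roots g" and "z \<noteq> 0"
  shows "inverse z \<in> ac_roots (reflect_poly g)"
proof -
  have "map_poly to_ac (reflect_poly g) = reflect_poly (map_poly to_ac g)"
    by (rule poly_eqI) (simp add: coeff_map_poly coeff_reflect_poly degree_map_poly)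
  with assms show ?thesis
    by (simp add: ac_roots_def poly_reflect_poly_nz)
qed

lemma ac_roots_monic_reflect:
  assumes "z \<in> ac_roots g" and "z \<noteq> 0"
  shows "inverse z \<in> ac_roots (monic_reflect g)"
  unfolding monic_reflect_def
  by (rule ac_roots_dvd[OF dvd_smult[OF dvd_refl] ac_roots_reflect_poly[OF assms]])

lemma ac_roots_linear [simp]: "z \<in> ac_roots [:c, 1:] \<longleftrightarrow> z = - to_ac c"
  by (auto simp: ac_roots_def map_poly_pCons eq_neg_iff_add_eq_0 add.commute)

context
  fixes n r s :: nat and f :: "nat \<Rightarrow> 'a::field poly" and \<alpha> :: "nat \<Rightarrow> 'a alg_closure"
  assumes n: "n > 0"
    and factorization: "reciprocal_factorization n r s f"
    and roots: "\<forall>j\<in>{1..r+s}. \<alpha> j \<in> ac_roots (f j)"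
begin

lemma monic_irreducible_factor:
  "g \<in> set (factor_list r s f) \<Longrightarrow> Polynomial.lead_coeff g = 1 \<and> irreducible g"
  using factorization by (auto simp: reciprocal_factorization_def)

lemma root_power: 
  assumes "j \<in> {1..r+s}"
  shows "\<alpha> j ^ n = 1"
proof -
  have "f j \<in> set (factor_list r s f)"
    using assms by (simp add: set_factor_list)
  then have "f j dvd prod_list (factor_list r s f)"
    by (rule prod_list_dvd)
  also have "\<dots> = Polynomial.monom 1 n - 1"
    using factorization by (simp add: reciprocal_factorization_def)
  finally have "\<alpha> j \<in> ac_roots (Polynomial.monom 1 n - 1)"
    using ac_roots_dvd roots assms by blast
  then show ?thesis
    by (simp add: ac_roots_def poly_to_ac_diff map_poly_monom poly_monom)
qed

lemma root_nonzero: "j \<in> {1..r+s} \<Longrightarrow> \<alpha> j \<noteq> 0"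
  using root_power[of j] n by (auto simp: power_0_left)

lemma inverse_root_self_reciprocal:
  assumes "1 < j" and "j \<le> r"
  shows "inverse (\<alpha> j) \<in> ac_roots (f j)"
proof -
  have "reflect_poly (f j) = f j"
    using factorization assms by (auto simp: reciprocal_factorization_def)
  then show ?thesis
    using ac_roots_reflect_poly[of "\<alpha> j" "f j"] roots root_nonzero[of j] assms by auto
qed

text \<open>
  This is what makes the change of basis in \<open>sigma\<close> invertible: \<open>\<plusminus>1\<close> are already the
  roots of the linear factors that the indices up to \<open>zeta n\<close> account for. For odd \<open>n\<close>, \<open>-1\<close> is an
  \<open>n\<close>-th root of unity only in characteristic 2, where it equals \<open>1\<close>.
\<close>
lemma root_square_neq_1:
  assumes "zeta n < j" and "j \<le> r"
  shows "\<alpha> j * \<alpha> j \<noteq> 1"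
proof
  assume "\<alpha> j * \<alpha> j = 1"
  then have pm: "\<alpha> j = 1 \<or> \<alpha> j = - 1"
    by (rule square_eq_1_iff[THEN iffD1])
  have j: "j \<in> {1..r}" "1 < j"
    using assms by (auto simp: zeta_def split: if_splits)
  have f1: "f 1 = [:-1, 1:]" and f2: "even n \<Longrightarrow> f 2 = [:1, 1:]"
    using factorization by (auto simp: reciprocal_factorization_def)
  have "distinct (map f [1..<r+1])"
    using factorization by (simp add: reciprocal_factorization_def factor_list_def del: upt_Suc)
  then have "inj_on f (set [1..<r+1])"
    by (simp only: distinct_map)
  also have "set [1..<r+1] = {1..r}"
    by auto
  finally have inj: "inj_on f {1..r}" .
  have same: "j = k" if k: "k \<in> {1..r}" "\<alpha> j \<in> ac_roots (f k)" for k
  proof -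
    have *: "Polynomial.lead_coeff (f i) = 1 \<and> irreducible (f i)" if "i \<in> {1..r}" for i
      using monic_irreducible_factor[of "f i"] that by (auto simp: set_factor_list)
    have "f j dvd f k"
      by (rule irreducible_dvd_if_common_root[OF _ _ k(2)]) (use * j(1) roots in auto)
    then have "f j = f k"
      using monic_irreducible_dvd_eq[of "f j" "f k"] * j(1) k by auto
    then show ?thesis
      using inj j(1) k(1) by (auto dest: inj_onD)
  qed
  have "\<alpha> j \<noteq> 1"
    using same[of 1] j f1 by auto
  with pm have minus: "\<alpha> j = - 1" by simp
  show False
  proof (cases "even n")
    case True
    then show False
      using same[of 2] j minus f2 assms by (auto simp: zeta_def)
  next
    case False
    then show False
      using root_power[of j] j minus \<open>\<alpha> j \<noteq> 1\<close> by auto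
  qed
qed

text \<open>
  One root per irreducible factor suffices; \<open>inverse (\<alpha> j)\<close> is the root that stands for the
  reciprocal partner of \<open>f j\<close>.
\<close>
lemma monom_minus_1_dvd:
  assumes "\<And>j. j \<in> {1..r+s} \<Longrightarrow> \<alpha> j \<in> ac_roots g"
    and "\<And>j. j \<in> {r+1..r+s} \<Longrightarrow> inverse (\<alpha> j) \<in> ac_roots g"
  shows "Polynomial.monom 1 n - 1 dvd g"
proof -
  have "h dvd g" if h: "h \<in> set (factor_list r s f)" for h
  proof -
    from h have "\<exists>z. z \<in> ac_roots h \<and> z \<in> ac_roots g"
      unfolding set_factor_list
    proof (elim UnE imageE)
      fix j assume "h = f j" "j \<in> {1..r+s}"
      then show ?thesis
        using roots assms(1) by blast
    next
      fix j assume j: "h = (monic_reflect \<circ> f) j" "j \<in> {r+1..r+s}"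
      then have "inverse (\<alpha> j) \<in> ac_roots h"
        using roots root_nonzero[of j] by (auto intro!: ac_roots_monic_reflect)
      then show ?thesis
        using assms(2) j(2) by blast
    qed
    then show ?thesis
      using irreducible_dvd_if_common_root monic_irreducible_factor[OF h] by blast
  qed
  then have "prod_list (factor_list r s f) dvd g"
    using factorization by (intro prod_list_monic_irreducible_dvd) (auto simp: reciprocal_factorization_def)
  then show ?thesis
    using factorization by (simp add: reciprocal_factorization_def)
qed

end

section \<open>Diagonal elements of the component ideals\<close>

lemma c2_mult:
  fixes w :: "int \<Rightarrow> 'a::comm_ring_1"
  assumes "w \<in> carrier C2_algebra"
  shows "(w \<otimes>\<^bsub>C2_algebra\<^esub> c2 x y) 0 = w 0 * x + w 1 * y"
    and "(w \<otimes>\<^bsub>C2_algebra\<^esub> c2 x y) 1 = w 0 * y + w 1 * x"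
proof -
  have w: "{g. w g \<noteq> 0} \<subseteq> {0, 1}"
    using assms by (force simp: group_algebra_def carrier_integer_mod_group)
  have c: "{g. c2 x y g \<noteq> 0} \<subseteq> {0, 1}"
    by (auto simp: c2_def)
  show "(w \<otimes>\<^bsub>C2_algebra\<^esub> c2 x y) 0 = w 0 * x + w 1 * y"
    and "(w \<otimes>\<^bsub>C2_algebra\<^esub> c2 x y) 1 = w 0 * y + w 1 * x"
    by (subst group_algebra_mult[OF _ _ w c]; simp add: c2_def)+
qed

text \<open>
  For these \<open>x\<close> and \<open>y\<close> the generator is \<open>1 - h\<close> or \<open>1 + h\<close>, and in every multiple of it the
  coefficients of \<open>1\<close> and \<open>h\<close> agree up to sign.
\<close>
lemma comp_I_scalar_eq_0:
  assumes "j \<le> zeta n" and "(x, y) \<in> {(0, 1), (1, 0)}" and "Inl (c2 a 0) \<in> comp_I n r \<alpha> j x y"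
  shows "a = 0"
proof -
  obtain w where w: "w \<in> carrier C2_algebra"
    and eq: "c2 a 0 = w \<otimes>\<^bsub>C2_algebra\<^esub> c2 (of_ac x + of_ac y) (of_ac x - of_ac y)"
    using assms(1,3) by (auto simp: comp_I_def)
  have "a = w 0 * (of_ac x + of_ac y) + w 1 * (of_ac x - of_ac y)"
    using fun_cong[OF eq, of 0] unfolding c2_mult(1)[OF w] by (simp add: c2_def)
  moreover have "0 = w 0 * (of_ac x - of_ac y) + w 1 * (of_ac x + of_ac y)"
    using fun_cong[OF eq, of 1] unfolding c2_mult(2)[OF w] by (simp add: c2_def)
  ultimately show ?thesis
    using assms(2) by auto
qed

lemma det_mat2 [simp]: "det (mat2 a b c d) = a * d - b * c"
  by (simp add: det_2 mat2_def)

lemma mat2_eq_iff: "mat2 a b c d = mat2 a' b' c' d' \<longleftrightarrow> a = a' \<and> b = b' \<and> c = c' \<and> d = d'"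
  by (auto simp: mat2_def vec_eq_iff forall_2)

lemma mat2_eq_0_iff: "mat2 a b c d = 0 \<longleftrightarrow> a = 0 \<and> b = 0 \<and> c = 0 \<and> d = 0"
  by (auto simp: mat2_def vec_eq_iff forall_2)

lemma comp_I_det_eq_0:
  assumes "zeta n < j" and "Inr M \<in> comp_I n r \<alpha> j x y"
  shows "det M = 0"
  using assms by (auto simp: comp_I_def)

lemma det_sigma:
  assumes "z \<noteq> 0" and "z * z \<noteq> 1"
  shows "det (sigma z M) = det M"
proof -
  define Z where "Z = mat2 1 (- z) 1 (- inverse z)"
  have "det Z \<noteq> 0"
    using assms by (auto simp: Z_def field_simps)
  then have "invertible Z"
    by (simp add: invertible_det_nz)
  then have "matrix_inv Z ** Z = mat 1"
    unfolding invertible_def matrix_inv_def by (rule someI2_ex) simp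
  then have "det (matrix_inv Z) * det Z = 1"
    by (metis det_mul det_I)
  moreover have "det (sigma z M) = det (matrix_inv Z) * det Z * det M"
    by (simp add: sigma_def Let_def Z_def[symmetric] det_mul)
  ultimately show ?thesis by simp
qed

section \<open>Weights and the action of the reflection\<close>

definition swap_halves :: "(bool \<times> int \<Rightarrow> 'a) \<Rightarrow> bool \<times> int \<Rightarrow> 'a" where
  "swap_halves u = (\<lambda>(e, i). u (\<not> e, i))"

lemma dihedral_algebra_carrier_iff:
  "u \<in> carrier (dihedral_algebra n) \<longleftrightarrow> (\<forall>e i. u (e, i) \<noteq> 0 \<longrightarrow> 0 \<le> i \<and> i < int n)"
proof -
  have "finite (carrier (dihedral_group n))"
    by (simp add: dihedral_group_def)
  then have "u \<in> carrier (dihedral_algebra n) \<longleftrightarrow> {g. u g \<noteq> 0} \<subseteq> carrier (dihedral_group n)"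
    by (auto simp: group_algebra_def intro: finite_subset)
  then show ?thesis
    by (auto simp: dihedral_group_def)
qed

text \<open>Left multiplication by \<open>b\<close> sends \<open>P(a) + b Q(a)\<close> to \<open>Q(a) + b P(a)\<close>.\<close>
lemma swap_halves_mem:
  fixes u :: "bool \<times> int \<Rightarrow> 'a::comm_ring_1"
  assumes "left_ideal C (dihedral_algebra n)" and "u \<in> C" and "u \<in> carrier (dihedral_algebra n)"
    and "n > 0"
  shows "swap_halves u \<in> C"
proof -
  define b :: "bool \<times> int \<Rightarrow> 'a" where "b = (\<lambda>g. if g = (True, 0) then 1 else 0)"
  have b: "{g. b g \<noteq> 0} \<subseteq> {(True, 0)}"
    by (auto simp: b_def)
  have u: "{g. u g \<noteq> 0} \<subseteq> UNIV \<times> {0..<int n}"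
    using assms(3) by (auto simp: dihedral_algebra_carrier_iff)
  have "b \<in> carrier (dihedral_algebra n)"
    using assms(4) by (auto simp: dihedral_algebra_carrier_iff b_def)
  then have "b \<otimes>\<^bsub>dihedral_algebra n\<^esub> u \<in> C"
    using assms(1,2) by (auto simp: left_ideal_def)
  moreover have "b \<otimes>\<^bsub>dihedral_algebra n\<^esub> u = swap_halves u"
  proof
    fix g :: "bool \<times> int"
    obtain e i where g: "g = (e, i)" by (cases g)
    have "(b \<otimes>\<^bsub>dihedral_algebra n\<^esub> u) g =
        (\<Sum>k\<in>UNIV \<times> {0..<int n}. if (True, 0) \<otimes>\<^bsub>dihedral_group n\<^esub> k = g then u k else 0)"
      by (subst group_algebra_mult[OF _ _ b u]) (simp_all add: b_def cong: if_cong)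
    also have "\<dots> = (\<Sum>k\<in>UNIV \<times> {0..<int n}. if (\<not> e, i) = k then u k else 0)"
      by (rule sum.cong) (auto simp: g dihedral_group_def)
    also have "\<dots> = swap_halves u g"
      using u by (auto simp: swap_halves_def g)
    finally show "(b \<otimes>\<^bsub>dihedral_algebra n\<^esub> u) g = swap_halves u g" .
  qed
  ultimately show ?thesis by simp
qed

lemma hamming_weight_halves:
  assumes "u \<in> carrier (dihedral_algebra n)"
  shows "hamming_weight u = hamming_weight (pr_a u) + hamming_weight (pr_a (swap_halves u))"
proof -
  let ?S = "\<lambda>e. {i. u (e, i) \<noteq> 0}"
  have fin: "finite (?S e)" for e
    by (rule finite_subset[of _ "{0..<int n}"])
       (use assms in \<open>auto simp: dihedral_algebra_carrier_iff\<close>)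
  have "{g. u g \<noteq> 0} = {False} \<times> ?S False \<union> {True} \<times> ?S True"
  proof (rule Set.set_eqI)
    fix g show "g \<in> {g. u g \<noteq> 0} \<longleftrightarrow> g \<in> {False} \<times> ?S False \<union> {True} \<times> ?S True"
      by (cases g; cases "fst g") simp_all
  qed
  then have "hamming_weight u = card (?S False) + card (?S True)"
    unfolding hamming_weight_def by (simp only:) (subst card_Un_disjoint, auto simp: fin card_cartesian_product_singleton)
  moreover have "{g. pr_a v g \<noteq> 0} = {False} \<times> {i. v (False, i) \<noteq> 0}" for v :: "bool \<times> int \<Rightarrow> 'a"
    by (auto simp: pr_a_def split: if_splits)
  ultimately show ?thesis
    by (simp add: hamming_weight_def card_cartesian_product_singleton swap_halves_def)
qed

lemma P_poly_eq_0_imp: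
  assumes "u \<in> carrier (dihedral_algebra n)" and "P_poly n u = 0"
  shows "pr_a u = (\<lambda>_. 0)"
proof -
  have "u (False, i) = 0" for i
  proof (rule ccontr)
    assume *: "u (False, i) \<noteq> 0"
    then have i: "0 \<le> i" "i < int n"
      using assms(1) by (auto simp: dihedral_algebra_carrier_iff)
    have "Polynomial.coeff (P_poly n u) (nat i) = u (False, i)"
      using i by (auto simp: P_poly_def coeff_sum)
    with * assms(2) show False by simp
  qed
  then show ?thesis
    by (auto simp: pr_a_def)
qed

lemma P_poly_eq_0_if_dvd:
  assumes "Polynomial.monom 1 n - 1 dvd P_poly n u" and "n > 0"
  shows "P_poly n (u :: bool \<times> int \<Rightarrow> 'a::field) = 0"
proof (rule ccontr)
  assume "P_poly n u \<noteq> 0"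
  then have "Polynomial.degree (Polynomial.monom 1 n - 1 :: 'a poly) \<le> Polynomial.degree (P_poly n u)"
    using assms(1) by (rule dvd_imp_degree_le[rotated])
  also have "\<dots> < n"
    unfolding P_poly_def using assms(2)
    by (intro le_less_trans[OF degree_sum_le[of _ _ "n - 1"]])
       (auto intro: order_trans[OF degree_monom_le])
  finally have "Polynomial.coeff (Polynomial.monom 1 n - 1 :: 'a poly) n = 0"
    by (rule coeff_eq_0)
  with assms(2) show False
    by simp
qed

lemma
  assumes "left_ideal C (dihedral_algebra n)" and "n > 0" 
  shows pr_a_subset_exterior_code: "pr_a ` C \<subseteq> exterior_code n C"
    and exterior_code_subset_carrier: "exterior_code n C \<subseteq> carrier (dihedral_algebra n)"
proof -
  show "pr_a ` C \<subseteq> exterior_code n C"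
    by (auto simp: exterior_code_def gen_left_ideal_def)
  interpret ring "dihedral_algebra n :: (bool \<times> int \<Rightarrow> 'a) ring"
    using assms(2) by (intro ring_group_algebra group_dihedral_group)
  have "left_ideal (carrier (dihedral_algebra n)) (dihedral_algebra n :: (bool \<times> int \<Rightarrow> 'a) ring)"
    unfolding left_ideal_def
    by (auto intro!: additive_subgroup.intro add.subgroup_self)
  moreover have "C \<subseteq> carrier (dihedral_algebra n)"
    using assms(1) by (simp add: left_ideal_def additive_subgroup.a_subset)
  then have "pr_a ` C \<subseteq> carrier (dihedral_algebra n)"
    by (fastforce simp: dihedral_algebra_carrier_iff pr_a_def split: if_splits)
  ultimately show "exterior_code n C \<subseteq> carrier (dihedral_algebra n)"
    by (auto simp: exterior_code_def gen_left_ideal_def)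
qed

lemma finite_hamming_weights:
  fixes D :: "(bool \<times> int \<Rightarrow> 'a::comm_ring_1) set"
  assumes "D \<subseteq> carrier (dihedral_algebra n)"
  shows "finite (hamming_weight ` D)"
proof (rule finite_subset)
  show "hamming_weight ` D \<subseteq> {..card (UNIV \<times> {0..<int n} :: (bool \<times> int) set)}"
  proof (rule image_subsetI)
    fix u :: "bool \<times> int \<Rightarrow> 'a" assume "u \<in> D"
    then have "{g. u g \<noteq> 0} \<subseteq> UNIV \<times> {0..<int n}"
      using assms by (auto simp: subset_iff dihedral_algebra_carrier_iff)
    then show "hamming_weight u \<in> {..card (UNIV \<times> {0..<int n} :: (bool \<times> int) set)}"
      unfolding hamming_weight_def atMost_iff by (intro card_mono) auto
  qed
qed simp

theorem theorem10:
  fixes q n r s :: nat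
    and f :: "nat \<Rightarrow> 'a::{field, finite} poly"
    and \<alpha> x :: "nat \<Rightarrow> 'a alg_closure"
    and C :: "(bool \<times> int \<Rightarrow> 'a) set"
    and J1 J2 J3 J4 :: "nat set"
  assumes "CARD('a) = q" and "n \<ge> 2" and "coprime q n"
    and "reciprocal_factorization n r s f"
    and "\<forall>j\<in>{1..r+s}. \<alpha> j \<in> ac_roots (f j)"
    and "left_ideal C (dihedral_algebra n)" and "C \<noteq> {\<zero>\<^bsub>dihedral_algebra n\<^esub>}"
    and "J1 \<subseteq> {1..r+s}" and "J2 \<subseteq> {1..r+s}" and "J3 \<subseteq> {1..r+s}" and "J4 \<subseteq> {zeta n + 1..r+s}"
    and "J1 \<inter> J2 = {}" and "J1 \<inter> J3 = {}" and "J1 \<inter> J4 = {}"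
    and "J2 \<inter> J3 = {}" and "J2 \<inter> J4 = {}" and "J3 \<inter> J4 = {}"
    and "even q \<longrightarrow> 1 \<notin> J2"
    and "J1 = {}" and "J2 \<inter> {r+1..r+s} = {}" and "J3 \<inter> {r+1..r+s} = {}"
    and "\<forall>j\<in>J4. x j \<in> comp_field n r \<alpha> j \<and> x j \<noteq> 0"
    and "decomposition n r s \<alpha> ` C =
      (\<Pi>\<^sub>E j\<in>{1..r+s}.
         if j \<in> J1 then comp_A n r \<alpha> j
         else if j \<in> J2 then comp_I n r \<alpha> j 0 1
         else if j \<in> J3 then comp_I n r \<alpha> j 1 0
         else if j \<in> J4 then comp_I n r \<alpha> j (- x j) 1
         else {comp_zero n j})"
  shows "min_distance C \<ge> 2 * min_distance (exterior_code n C)"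
proof -
  note factorization = assms(4) and roots = assms(5) and ideal = assms(6)
  note J4_range = assms(11) and J1_empty = assms(19) and J2_J3_range = assms(20,21)
    and x_nonzero = assms(22) and image = assms(23)
  have n: "n > 0" using assms(2) by simp
  have C_carrier: "C \<subseteq> carrier (dihedral_algebra n)"
    using ideal by (simp add: left_ideal_def additive_subgroup.a_subset)
  define B where "B = (\<lambda>j. if j \<in> J1 then comp_A n r \<alpha> j
         else if j \<in> J2 then comp_I n r \<alpha> j 0 1
         else if j \<in> J3 then comp_I n r \<alpha> j 1 0
         else if j \<in> J4 then comp_I n r \<alpha> j (- x j) 1
         else {comp_zero n j})"
  have comp: "comp_map n r \<alpha> j u \<in> B j" if "u \<in> C" "j \<in> {1..r+s}" for u j
  proof -
    have "decomposition n r s \<alpha> u \<in> Pi\<^sub>E {1..r+s} B"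
      using that(1) image unfolding B_def by blast
    then have "decomposition n r s \<alpha> u j \<in> B j"
      using that(2) by (rule PiE_mem)
    then show ?thesis
      using that(2) by (simp add: decomposition_def)
  qed
  \<comment> \<open>The second hypothesis says \<open>Q = 0\<close>: a word without \<open>b\<close>-part has no \<open>a\<close>-part either.\<close>
  have trivial: "pr_a u = (\<lambda>_. 0)" if u: "u \<in> C" and half: "pr_a (swap_halves u) = (\<lambda>_. 0)" for u
  proof -
    define P where "P = P_poly n u"
    have Q: "Q_poly n u = 0"
      using fun_cong[OF half, of "(False, _)"] by (simp add: Q_poly_def pr_a_def swap_halves_def)
    have root: "\<alpha> j \<in> ac_roots P \<and> inverse (\<alpha> j) \<in> ac_roots P" if j: "j \<in> {1..r+s}" for j
    proof -
      consider "j \<le> zeta n" | "zeta n < j" "j \<le> r" | "zeta n < j" "r < j"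
        by linarith
      then show ?thesis
      proof cases
        case 1
        \<comment> \<open>The linear factors \<open>x - 1\<close> and \<open>x + 1\<close>: here \<open>\<alpha> j = e\<close> is its own inverse.\<close>
        define e :: 'a where "e = (if j = 1 then 1 else - 1)"
        have "Inl (c2 (poly P e) 0) \<in> B j"
          using comp[OF u j] 1 Q by (simp add: comp_map_def gamma_def e_def P_def)
        moreover have "j \<notin> J4"
          using 1 J4_range by auto
        moreover have "poly P e = 0" if "Inl (c2 (poly P e) 0) = (comp_zero n j :: 'a component)"
          using that 1 by (auto simp: comp_zero_def group_algebra_def c2_def fun_eq_iff split: if_splits)
        ultimately have "poly P e = 0"
          using comp_I_scalar_eq_0[OF 1, of 0 1] comp_I_scalar_eq_0[OF 1, of 1 0] J1_empty
          by (auto simp: B_def split: if_splits)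
        moreover have "\<alpha> j = to_ac e"
        proof (cases "j = 1")
          case True
          then show ?thesis
            using bspec[OF roots j] factorization by (simp add: reciprocal_factorization_def e_def)
        next
          case False
          then have "j = 2" "even n"
            using 1 j by (auto simp: zeta_def split: if_splits)
          then show ?thesis
            using bspec[OF roots j] factorization by (simp add: reciprocal_factorization_def e_def)
        qed
        moreover have "inverse e = e"
          by (simp add: e_def)
        ultimately show ?thesis
          by (simp add: ac_roots_def poly_map_poly_to_ac flip: to_ac_inverse)
      next
        case 2
        have "Inr (sigma (\<alpha> j) (tau n (\<alpha> j) u)) \<in> B j"
          using comp[OF u j] 2 by (simp add: comp_map_def)
        then have "det (sigma (\<alpha> j) (tau n (\<alpha> j) u)) = 0"
          using 2 J1_empty comp_I_det_eq_0[OF 2(1)]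
          by (auto simp: B_def comp_zero_def det_2 split: if_splits)
        then have "det (tau n (\<alpha> j) u) = 0"
          using root_nonzero[OF n factorization roots j] root_square_neq_1[OF n factorization roots 2]
          by (simp add: det_sigma)
        then have one_root: "\<alpha> j \<in> ac_roots P \<or> inverse (\<alpha> j) \<in> ac_roots P"
          by (auto simp: tau_def Let_def Q ac_roots_def P_def)
        \<comment> \<open>\<open>\<alpha> j\<close> and its inverse are conjugate: a zero of \<open>P\<close> at one of them makes \<open>f j\<close> divide \<open>P\<close>.\<close>
        have "1 < j"
          using 2 by (auto simp: zeta_def split: if_splits)
        then have roots_f: "\<alpha> j \<in> ac_roots (f j)" "inverse (\<alpha> j) \<in> ac_roots (f j)"
          using roots j inverse_root_self_reciprocal[OF n factorization roots _ 2(2)] by auto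
        have "irreducible (f j)"
          using monic_irreducible_factor[OF n factorization roots, of "f j"] j 2(2) by (auto simp: set_factor_list)
        then have "f j dvd P"
          using one_root roots_f irreducible_dvd_if_common_root by blast
        then show ?thesis
          using roots_f ac_roots_dvd by blast
      next
        case 3
        have "Inr (mat2 (poly (map_poly to_ac P) (\<alpha> j)) 0 0 (poly (map_poly to_ac P) (inverse (\<alpha> j)))) \<in> B j"
          using comp[OF u j] 3 by (simp add: comp_map_def tau_def Let_def Q P_def)
        \<comment> \<open>So \<open>B j\<close> is \<open>0\<close> or consists of matrices with rows \<open>(k, k x j)\<close>, \<open>(t, t x j)\<close>.\<close>
        moreover have "j \<notin> J2" "j \<notin> J3"
          using j 3 J2_J3_range by auto
        moreover have "x j \<noteq> 0" if "j \<in> J4"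
          using that x_nonzero by auto
        ultimately show ?thesis
          using 3 J1_empty
          by (auto simp: B_def comp_zero_def comp_I_def mat2_eq_iff mat2_eq_0_iff ac_roots_def split: if_splits)
      qed
    qed
    then have "Polynomial.monom 1 n - 1 dvd P"
      using monom_minus_1_dvd[OF n factorization roots] by auto
    then have "P_poly n u = 0"
      using P_poly_eq_0_if_dvd n P_def by blast
    then show ?thesis
      using P_poly_eq_0_imp u C_carrier by blast
  qed
  have swap: "swap_halves u \<in> C" if "u \<in> C" for u
    using swap_halves_mem[OF ideal that _ n] that C_carrier by blast
  have lower: "min_distance (exterior_code n C) \<le> hamming_weight (pr_a u)"
    if "u \<in> C" "pr_a u \<noteq> (\<lambda>_. 0)" for u
    unfolding min_distance_def
    using that pr_a_subset_exterior_code[OF ideal n] exterior_code_subset_carrier[OF ideal n]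
    by (intro Min_le finite_hamming_weights[of _ n]) auto
  have "(\<lambda>_. 0) \<in> C"
    using additive_subgroup.zero_closed[of C "dihedral_algebra n"] ideal
    by (simp add: left_ideal_def group_algebra_def)
  then have "C - {\<lambda>_. 0} \<noteq> {}"
    using assms(7) by (auto simp: group_algebra_def)
  then have "min_distance C \<in> hamming_weight ` (C - {\<lambda>_. 0})"
    unfolding min_distance_def using C_carrier by (intro Min_in finite_hamming_weights[of _ n]) auto
  then obtain c where c: "c \<in> C" "c \<noteq> (\<lambda>_. 0)" "min_distance C = hamming_weight c"
    by auto
  have swap_swap: "swap_halves (swap_halves c) = c"
    by (simp add: swap_halves_def fun_eq_iff)
  have "c = (\<lambda>_. 0)" if "pr_a c = (\<lambda>_. 0)" "pr_a (swap_halves c) = (\<lambda>_. 0)"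
  proof
    fix g show "c g = 0"
      using fun_cong[OF that(1), of "(False, snd g)"] fun_cong[OF that(2), of "(False, snd g)"]
      by (cases g; cases "fst g") (simp_all add: pr_a_def swap_halves_def)
  qed
  then have "pr_a c \<noteq> (\<lambda>_. 0)" "pr_a (swap_halves c) \<noteq> (\<lambda>_. 0)"
    using c(2) trivial[OF c(1)] trivial[OF swap[OF c(1)]] swap_swap by auto
  then have "2 * min_distance (exterior_code n C) \<le> hamming_weight (pr_a c) + hamming_weight (pr_a (swap_halves c))"
    using lower[OF c(1)] lower[OF swap[OF c(1)]] by simp
  also have "\<dots> = min_distance C"
    using hamming_weight_halves[of c n] c C_carrier by auto
  finally show ?thesis .
qed

end
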